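(* For every generalized metric space $X$, the Isbell completion $I(X)$ and the Hirai–Koichi tight span $\mathcal{E}_{\mathrm{HK}}(X)$ coincide: they are equal as sets of pairs of functions $X\to[0,\infty]$, and their generalized metrics agree.
   Context: A generalized metric space is a set $X$ with $d\colon X\times X\to[0,\infty]$ such that $d(x,x)=0$ and $d(x,y)+d(y,z)\ge d(x,z)$ for all $x,y,z\in X$ (no symmetry, separation or finiteness). For $a,b\in[0,\infty]$ write $b\dot{-}a:=\max(b-a,0)$ (with $\infty\dot{-}\infty=0$). A presheaf on $X$ is a function $f\colon X\to[0,\infty]$ with $d(x,x')\ge f(x)\dot{-}f(x')$ for all $x,x'$; the space $\widehat X$ of presheaves has generalized metric $d_{\widehat X}(f,f')=\sup_{x}(f'(x)\dot{-}f(x))$. A co-presheaf is a function $g\colon X\to[0,\infty]$ with $d(x,x')\ge g(x')\dot{-}g(x)$ for all $x,x'$; the space $\check X^{\mathrm{op}}$ of op-co-presheaves has generalized metric $d_{\check X^{\mathrm{op}}}(g,g')=\sup_x(g(x)\dot{-}g'(x))$. Define $L(f)(y)=\sup_{x\in X}(d(x,y)\dot{-}f(x))$ for $f\in\widehat X$ and $R(g)(x)=\sup_{y\in X}(d(x,y)\dot{-}g(y))$ for $g\in\check X^{\mathrm{op}}$. The Isbell completion is $I(X)=\{(f,g)\in\widehat X\times\check X^{\mathrm{op}}\mid L(f)=g,\ R(g)=f\}$ with generalized metric $d_{I(X)}((f,g),(f',g'))=\max\{d_{\widehat X}(f,f'),\,d_{\check X^{\mathrm{op}}}(g,g')\}$.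 A pair $(f,g)$ of functions $f,g\colon X\to[0,\infty]$ is triangular if $f(x)+g(y)\ge d(x,y)$ for all $x,y\in X$; it is minimal if every triangular pair $(f',g')$ with $f'(x)\le f(x)$ and $g'(y)\le g(y)$ for all $x,y\in X$ equals $(f,g)$. The Hirai–Koichi tight span $\mathcal{E}_{\mathrm{HK}}(X)$ is the set of minimal triangular pairs, with generalized metric $d_{\mathcal{E}_{\mathrm{HK}}(X)}((f,g),(f',g'))=\sup_{x\in X}\max(f'(x)\dot{-}f(x),\,g(x)\dot{-}g'(x))$. *)

theory Defs
  imports "HOL-Library.Extended_Nonnegative_Real" "HOL-Library.FuncSet"
begin

text \<open>
  A space is given by a carrier set \<open>X\<close>, possibly empty, and a function \<open>d\<close> of which only the
  values on \<open>X\<close> matter. Functions \<open>X \<rightarrow> [0,\<infinity>]\<close> are the extensional ones, so that equality of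
  HOL functions is equality of functions on \<open>X\<close>.
\<close>

locale gen_metric_space =
  fixes X :: "'a set" and d :: "'a \<Rightarrow> 'a \<Rightarrow> ennreal"
  assumes dist_self: "x \<in> X \<Longrightarrow> d x x = 0"
    and dist_triangle: "x \<in> X \<Longrightarrow> y \<in> X \<Longrightarrow> z \<in> X \<Longrightarrow> d x z \<le> d x y + d y z"

abbreviation ext_funs :: "'a set \<Rightarrow> ('a \<Rightarrow> ennreal) set" where
  "ext_funs X \<equiv> X \<rightarrow>\<^sub>E UNIV"

text \<open>
  \<open>monus b a\<close> is \<open>max (b - a) 0\<close> with \<open>\<infinity> - \<infinity> = 0\<close>. Subtraction on \<open>ennreal\<close> is already truncated
  at \<open>0\<close>, but there \<open>\<infinity> - \<infinity> = \<infinity>\<close>.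
\<close>

definition monus :: "ennreal \<Rightarrow> ennreal \<Rightarrow> ennreal" where
  "monus b a = (if b \<le> a then 0 else b - a)"

definition presheaves :: "'a set \<Rightarrow> ('a \<Rightarrow> 'a \<Rightarrow> ennreal) \<Rightarrow> ('a \<Rightarrow> ennreal) set" where
  "presheaves X d = {f \<in> ext_funs X. \<forall>x\<in>X. \<forall>x'\<in>X. monus (f x) (f x') \<le> d x x'}"

definition presheaf_dist :: "'a set \<Rightarrow> ('a \<Rightarrow> ennreal) \<Rightarrow> ('a \<Rightarrow> ennreal) \<Rightarrow> ennreal" where
  "presheaf_dist X f f' = (SUP x\<in>X. monus (f' x) (f x))"

definition copresheaves :: "'a set \<Rightarrow> ('a \<Rightarrow> 'a \<Rightarrow> ennreal) \<Rightarrow> ('a \<Rightarrow> ennreal) set" where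
  "copresheaves X d = {g \<in> ext_funs X. \<forall>x\<in>X. \<forall>x'\<in>X. monus (g x') (g x) \<le> d x x'}"

definition op_copresheaf_dist :: "'a set \<Rightarrow> ('a \<Rightarrow> ennreal) \<Rightarrow> ('a \<Rightarrow> ennreal) \<Rightarrow> ennreal" where
  "op_copresheaf_dist X g g' = (SUP x\<in>X. monus (g x) (g' x))"

definition isbell_L ::
    "'a set \<Rightarrow> ('a \<Rightarrow> 'a \<Rightarrow> ennreal) \<Rightarrow> ('a \<Rightarrow> ennreal) \<Rightarrow> 'a \<Rightarrow> ennreal" where
  "isbell_L X d f = (\<lambda>y\<in>X. SUP x\<in>X. monus (d x y) (f x))"

definition isbell_R ::
    "'a set \<Rightarrow> ('a \<Rightarrow> 'a \<Rightarrow> ennreal) \<Rightarrow> ('a \<Rightarrow> ennreal) \<Rightarrow> 'a \<Rightarrow> ennreal" where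
  "isbell_R X d g = (\<lambda>x\<in>X. SUP y\<in>X. monus (d x y) (g y))"

definition isbell_completion ::
    "'a set \<Rightarrow> ('a \<Rightarrow> 'a \<Rightarrow> ennreal) \<Rightarrow> (('a \<Rightarrow> ennreal) \<times> ('a \<Rightarrow> ennreal)) set" where
  "isbell_completion X d =
     {(f, g). f \<in> presheaves X d \<and> g \<in> copresheaves X d \<and> isbell_L X d f = g \<and> isbell_R X d g = f}"

fun isbell_dist ::
    "'a set \<Rightarrow> ('a \<Rightarrow> ennreal) \<times> ('a \<Rightarrow> ennreal) \<Rightarrow> ('a \<Rightarrow> ennreal) \<times> ('a \<Rightarrow> ennreal) \<Rightarrow> ennreal" where
  "isbell_dist X (f, g) (f', g') = max (presheaf_dist X f f') (op_copresheaf_dist X g g')"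

definition triangular_pairs ::
    "'a set \<Rightarrow> ('a \<Rightarrow> 'a \<Rightarrow> ennreal) \<Rightarrow> (('a \<Rightarrow> ennreal) \<times> ('a \<Rightarrow> ennreal)) set" where
  "triangular_pairs X d =
     {(f, g). f \<in> ext_funs X \<and> g \<in> ext_funs X \<and> (\<forall>x\<in>X. \<forall>y\<in>X. f x + g y \<ge> d x y)}"

definition hk_tight_span ::
    "'a set \<Rightarrow> ('a \<Rightarrow> 'a \<Rightarrow> ennreal) \<Rightarrow> (('a \<Rightarrow> ennreal) \<times> ('a \<Rightarrow> ennreal)) set" where
  "hk_tight_span X d =
     {(f, g). (f, g) \<in> triangular_pairs X d \<and>
        (\<forall>f' g'. (f', g') \<in> triangular_pairs X d \<and> (\<forall>x\<in>X. f' x \<le> f x) \<and> (\<forall>y\<in>X. g' y \<le> g y)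
           \<longrightarrow> (f', g') = (f, g))}"

fun hk_dist ::
    "'a set \<Rightarrow> ('a \<Rightarrow> ennreal) \<times> ('a \<Rightarrow> ennreal) \<Rightarrow> ('a \<Rightarrow> ennreal) \<times> ('a \<Rightarrow> ennreal) \<Rightarrow> ennreal" where
  "hk_dist X (f, g) (f', g') = (SUP x\<in>X. max (monus (f' x) (f x)) (monus (g x) (g' x)))"

end

theory Submission
  imports Defs
begin

text \<open>
  Truncated subtraction is residual to addition, so triangularity \<open>d x y \<le> f x + g y\<close> can be
  solved for either function: it says \<open>L f \<le> g\<close> pointwise, and equally \<open>R g \<le> f\<close> pointwise. Thus
  \<open>L f\<close> is the least partner of \<open>f\<close>, \<open>R g\<close> is the least partner of \<open>g\<close>, and \<open>L\<close> and \<open>R\<close> form an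
  antitone Galois connection.

  A minimal pair cannot be lowered in either coordinate alone, which forces \<open>g = L f\<close> and
  \<open>f = R g\<close>; conversely, since \<open>L\<close> and \<open>R\<close> reverse the order, lowering one coordinate of a pair
  with \<open>g = L f\<close> and \<open>f = R g\<close> could only raise the other, so such a pair is minimal. The
  presheaf and co-presheaf conditions come for free, because the triangle inequality makes every
  value of \<open>R\<close> a presheaf and every value of \<open>L\<close> a co-presheaf. The two metrics agree because
  suprema commute with binary maxima.
\<close>

text \<open>
  Residuation forces the convention \<open>\<infinity> - \<infinity> = 0\<close>: if \<open>c = a = \<infinity>\<close>, the right-hand side is true for
  every \<open>b\<close>, so the truncated difference must be \<open>0\<close>.
\<close>

lemma monus_le_iff: "monus c a \<le> b \<longleftrightarrow> c \<le> a + b"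
proof (cases "c \<le> a")
  case True
  then have "c \<le> a + b"
    by (rule order_trans) simp
  with True show ?thesis
    by (simp add: monus_def)
next
  case False
  then have "a < top"
    by (auto simp: less_top[symmetric])
  with False show ?thesis
    by (auto simp: monus_def ennreal_minus_le_iff)
qed

lemma isbell_L_le_iff:
  "y \<in> X \<Longrightarrow> isbell_L X d f y \<le> b \<longleftrightarrow> (\<forall>x\<in>X. d x y \<le> f x + b)"
  by (simp add: isbell_L_def SUP_le_iff monus_le_iff)

lemma isbell_R_le_iff:
  "x \<in> X \<Longrightarrow> isbell_R X d g x \<le> a \<longleftrightarrow> (\<forall>y\<in>X. d x y \<le> a + g y)"
  by (simp add: isbell_R_def SUP_le_iff monus_le_iff add.commute)

lemma triangular_iff_isbell_L_le:
  assumes "f \<in> ext_funs X" "g \<in> ext_funs X"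
  shows "(f, g) \<in> triangular_pairs X d \<longleftrightarrow> (\<forall>y\<in>X. isbell_L X d f y \<le> g y)"
  using assms by (auto simp: triangular_pairs_def isbell_L_le_iff)

lemma triangular_iff_isbell_R_le:
  assumes "f \<in> ext_funs X" "g \<in> ext_funs X"
  shows "(f, g) \<in> triangular_pairs X d \<longleftrightarrow> (\<forall>x\<in>X. isbell_R X d g x \<le> f x)"
  using assms by (auto simp: triangular_pairs_def isbell_R_le_iff)

lemma isbell_L_ext: "isbell_L X d f \<in> ext_funs X"
  by (simp add: isbell_L_def)

lemma isbell_R_ext: "isbell_R X d g \<in> ext_funs X"
  by (simp add: isbell_R_def)

lemma triangular_isbell_L: "f \<in> ext_funs X \<Longrightarrow> (f, isbell_L X d f) \<in> triangular_pairs X d"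
  by (simp add: triangular_iff_isbell_L_le isbell_L_ext)

lemma triangular_isbell_R: "g \<in> ext_funs X \<Longrightarrow> (isbell_R X d g, g) \<in> triangular_pairs X d"
  by (simp add: triangular_iff_isbell_R_le isbell_R_ext)

lemma isbell_L_antimono:
  assumes "\<And>x. x \<in> X \<Longrightarrow> f' x \<le> f x" "y \<in> X"
  shows "isbell_L X d f y \<le> isbell_L X d f' y"
  unfolding isbell_L_le_iff[OF assms(2)]
proof
  fix x assume "x \<in> X"
  then have "d x y \<le> f' x + isbell_L X d f' y"
    using isbell_L_le_iff[of y X d f' "isbell_L X d f' y"] assms(2) by simp
  also have "\<dots> \<le> f x + isbell_L X d f' y"
    using assms(1) \<open>x \<in> X\<close> by (simp add: add_right_mono)
  finally show "d x y \<le> f x + isbell_L X d f' y" .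
qed

lemma isbell_R_antimono:
  assumes "\<And>y. y \<in> X \<Longrightarrow> g' y \<le> g y" "x \<in> X"
  shows "isbell_R X d g x \<le> isbell_R X d g' x"
  unfolding isbell_R_le_iff[OF assms(2)]
proof
  fix y assume "y \<in> X"
  then have "d x y \<le> isbell_R X d g' x + g' y"
    using isbell_R_le_iff[of x X d g' "isbell_R X d g' x"] assms(2) by simp
  also have "\<dots> \<le> isbell_R X d g' x + g y"
    using assms(1) \<open>y \<in> X\<close> by (simp add: add_left_mono)
  finally show "d x y \<le> isbell_R X d g' x + g y" .
qed

text \<open>
  As \<open>L f y\<close> is the least \<open>b\<close> with \<open>d x y \<le> f x + b\<close> for all \<open>x\<close>, it suffices that
  \<open>L f y + d y y'\<close> is such a bound for \<open>y'\<close>, and this is the triangle inequality through \<open>y\<close>.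
\<close>

lemma (in gen_metric_space) isbell_L_copresheaf: "isbell_L X d f \<in> copresheaves X d"
proof -
  have "isbell_L X d f y' \<le> isbell_L X d f y + d y y'" if y: "y \<in> X" "y' \<in> X" for y y'
    unfolding isbell_L_le_iff[OF y(2)]
  proof
    fix x assume x: "x \<in> X"
    have "d x y' \<le> d x y + d y y'"
      using dist_triangle x y by blast
    also have "\<dots> \<le> (f x + isbell_L X d f y) + d y y'"
      using isbell_L_le_iff[of y X d f "isbell_L X d f y"] x y(1) by (simp add: add_right_mono)
    finally show "d x y' \<le> f x + (isbell_L X d f y + d y y')"
      by (simp add: add.assoc)
  qed
  then show ?thesis
    by (simp add: copresheaves_def monus_le_iff isbell_L_ext)
qed

lemma (in gen_metric_space) isbell_R_presheaf: "isbell_R X d g \<in> presheaves X d"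
proof -
  have "isbell_R X d g x \<le> isbell_R X d g x' + d x x'" if x: "x \<in> X" "x' \<in> X" for x x'
    unfolding isbell_R_le_iff[OF x(1)]
  proof
    fix y assume y: "y \<in> X"
    have "d x y \<le> d x x' + d x' y"
      using dist_triangle x y by blast
    also have "\<dots> \<le> d x x' + (isbell_R X d g x' + g y)"
      using isbell_R_le_iff[of x' X d g "isbell_R X d g x'"] x(2) y by (simp add: add_left_mono)
    finally show "d x y \<le> (isbell_R X d g x' + d x x') + g y"
      by (simp add: ac_simps)
  qed
  then show ?thesis
    by (simp add: presheaves_def monus_le_iff isbell_R_ext)
qed

lemma (in gen_metric_space) isbell_completion_iff_fixed:
  "(f, g) \<in> isbell_completion X d \<longleftrightarrow> isbell_L X d f = g \<and> isbell_R X d g = f"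
  using isbell_L_copresheaf[of f] isbell_R_presheaf[of g] by (auto simp: isbell_completion_def)

text \<open>
  Minimality lets \<open>(f, g)\<close> be compared with the triangular pairs \<open>(f, L f)\<close> and \<open>(R g, g)\<close>, which
  lie below it because \<open>L f\<close> and \<open>R g\<close> are least partners. Conversely, a triangular pair
  \<open>(f', g')\<close> below a fixed pair satisfies \<open>g = L f \<le> L f' \<le> g'\<close> and \<open>f = R g \<le> R g' \<le> f'\<close>.
\<close>

lemma hk_tight_span_iff_fixed:
  "(f, g) \<in> hk_tight_span X d \<longleftrightarrow> isbell_L X d f = g \<and> isbell_R X d g = f"
proof
  assume min: "(f, g) \<in> hk_tight_span X d"
  then have tri: "(f, g) \<in> triangular_pairs X d"
    and least: "\<And>f' g'. (f', g') \<in> triangular_pairs X d \<Longrightarrow> \<forall>x\<in>X. f' x \<le> f x \<Longrightarrow>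
      \<forall>y\<in>X. g' y \<le> g y \<Longrightarrow> (f', g') = (f, g)"
    by (simp_all add: hk_tight_span_def)
  have ext: "f \<in> ext_funs X" "g \<in> ext_funs X"
    using tri by (simp_all add: triangular_pairs_def)
  have "(f, isbell_L X d f) = (f, g)"
    using tri ext by (intro least triangular_isbell_L) (simp_all add: triangular_iff_isbell_L_le)
  moreover have "(isbell_R X d g, g) = (f, g)"
    using tri ext by (intro least triangular_isbell_R) (simp_all add: triangular_iff_isbell_R_le)
  ultimately show "isbell_L X d f = g \<and> isbell_R X d g = f"
    by simp
next
  assume fixed: "isbell_L X d f = g \<and> isbell_R X d g = f"
  then have ext: "f \<in> ext_funs X" "g \<in> ext_funs X"
    using isbell_L_ext[of X d f] isbell_R_ext[of X d g] by simp_all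
  have "(f', g') = (f, g)"
    if tri: "(f', g') \<in> triangular_pairs X d"
      and le: "\<forall>x\<in>X. f' x \<le> f x" "\<forall>y\<in>X. g' y \<le> g y" for f' g'
  proof -
    have ext': "f' \<in> ext_funs X" "g' \<in> ext_funs X"
      using tri by (simp_all add: triangular_pairs_def)
    have "g y \<le> g' y" if "y \<in> X" for y
    proof -
      have "g y = isbell_L X d f y"
        using fixed by simp
      also have "\<dots> \<le> isbell_L X d f' y"
        using le(1) that by (simp add: isbell_L_antimono)
      also have "\<dots> \<le> g' y"
        using tri ext' that by (simp add: triangular_iff_isbell_L_le)
      finally show ?thesis .
    qed
    moreover have "f x \<le> f' x" if "x \<in> X" for x
    proof -
      have "f x = isbell_R X d g x"
        using fixed by simp
      also have "\<dots> \<le> isbell_R X d g' x"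
        using le(2) that by (simp add: isbell_R_antimono)
      also have "\<dots> \<le> f' x"
        using tri ext' that by (simp add: triangular_iff_isbell_R_le)
      finally show ?thesis .
    qed
    ultimately have "f' x = f x" "g' x = g x" if "x \<in> X" for x
      using le that by (simp_all add: order_antisym)
    then have "f' = f" "g' = g"
      by (simp_all add: PiE_ext[OF ext'(1) ext(1)] PiE_ext[OF ext'(2) ext(2)])
    then show ?thesis
      by simp
  qed
  moreover have "(f, g) \<in> triangular_pairs X d"
    using triangular_isbell_L[OF ext(1), of d] fixed by simp
  ultimately show "(f, g) \<in> hk_tight_span X d"
    unfolding hk_tight_span_def by blast
qed

lemma isbell_dist_eq_hk_dist: "isbell_dist X p q = hk_dist X p q"
proof -
  have "max (SUP x\<in>X. u x) (SUP x\<in>X. v x) = (SUP x\<in>X. max (u x) (v x))"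
    for u v :: "'a \<Rightarrow> ennreal"
    unfolding sup_max[symmetric] by (rule complete_lattice_class.SUP_sup_distrib)
  then show ?thesis
    by (cases p; cases q) (simp add: presheaf_dist_def op_copresheaf_dist_def)
qed

theorem theorem7:
  fixes X :: "'a set" and d :: "'a \<Rightarrow> 'a \<Rightarrow> ennreal"
  assumes "gen_metric_space X d"
  shows "isbell_completion X d = hk_tight_span X d \<and>
    (\<forall>p \<in> isbell_completion X d. \<forall>q \<in> isbell_completion X d. isbell_dist X p q = hk_dist X p q)"
proof -
  have "p \<in> isbell_completion X d \<longleftrightarrow> p \<in> hk_tight_span X d" for p
    by (cases p)
      (simp add: gen_metric_space.isbell_completion_iff_fixed[OF assms] hk_tight_span_iff_fixed)
  then show ?thesis
    using isbell_dist_eq_hk_dist by blast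
qed

end
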